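(* Let $X$ be a real normed space and let $K\subset X$ be a convex body. Then for all $\mathbf{x}\in K$ we have $$\beta(K,\mathbf{x})=\frac{1-\lambda(K,\mathbf{x})}{1+\lambda(K,\mathbf{x})}.$$
   Context: $X$ is a real normed space, $X\neq\{0\}$; $X^*$ is its dual and $S^*$ the unit sphere of $X^*$. A convex body is a bounded, closed, convex set with nonempty interior. The support function of $K$ is $h(K,\mathbf{v}^* )=\sup_{\mathbf{x}\in K}\langle \mathbf{v}^*,\mathbf{x}\rangle$, and $w(K,\mathbf{v}^* )=h(K,\mathbf{v}^* )+h(K,-\mathbf{v}^* )$. Define $$t(K,\mathbf{v}^*,\mathbf{x})=\frac{2\langle\mathbf{v}^*,\mathbf{x}\rangle-h(K,\mathbf{v}^* )+h(K,-\mathbf{v}^* )}{w(K,\mathbf{v}^* )},\qquad \lambda(K,\mathbf{x})=\sup_{\mathbf{v}^*\in S^*}|t(K,\mathbf{v}^*,\mathbf{x})|=\sup_{\mathbf{v}^*\in S^*}t(K,\mathbf{v}^*,\mathbf{x}),$$ and, for $\mathbf{x}\in K$, $\beta(K,\mathbf{x})=\sup\{\lambda\ge0:\ -\lambda(K-\mathbf{x})+\mathbf{x}\subset K\}$. *)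

theory Defs
  imports "HOL-Analysis.Analysis"
begin

text \<open>
  The dual of a real normed space \<open>'a\<close> is the type \<open>'a \<Rightarrow>\<^sub>L real\<close> of bounded linear
  functionals with the operator norm; its unit sphere is \<open>sphere 0 1\<close>.
  All suprema are taken in \<open>real\<close>. For a convex body \<open>K\<close> of a nontrivial space and \<open>x \<in> K\<close> the sets
  involved are nonempty and bounded above, so these are genuine suprema.
\<close>

definition convex_body :: "'a::real_normed_vector set \<Rightarrow> bool" where
  "convex_body K \<longleftrightarrow> bounded K \<and> closed K \<and> convex K \<and> interior K \<noteq> {}"

definition support_fun :: "'a::real_normed_vector set \<Rightarrow> ('a \<Rightarrow>\<^sub>L real) \<Rightarrow> real" where
  "support_fun K v = (SUP x\<in>K. blinfun_apply v x)"

definition width_fun :: "'a::real_normed_vector set \<Rightarrow> ('a \<Rightarrow>\<^sub>L real) \<Rightarrow> real" where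
  "width_fun K v = support_fun K v + support_fun K (- v)"

definition t_fun :: "'a::real_normed_vector set \<Rightarrow> ('a \<Rightarrow>\<^sub>L real) \<Rightarrow> 'a \<Rightarrow> real" where
  "t_fun K v x =
     (2 * blinfun_apply v x - support_fun K v + support_fun K (- v)) / width_fun K v"

definition lambda_fun :: "'a::real_normed_vector set \<Rightarrow> 'a \<Rightarrow> real" where
  "lambda_fun K x = (SUP v\<in>sphere 0 1. \<bar>t_fun K v x\<bar>)"

definition beta_fun :: "'a::real_normed_vector set \<Rightarrow> 'a \<Rightarrow> real" where
  "beta_fun K x = Sup {l. 0 \<le> l \<and> (\<lambda>y. - l *\<^sub>R (y - x) + x) ` K \<subseteq> K}"

lemma t_fun_minus: "t_fun K (- v) x = - t_fun K v x"
proof -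
  have "width_fun K (- v) = width_fun K v"
    by (simp add: width_fun_def)
  moreover have "2 * blinfun_apply (- v) x - support_fun K (- v) + support_fun K (- (- v))
      = - (2 * blinfun_apply v x - support_fun K v + support_fun K (- v))"
    by (simp add: blinfun.minus_left)
  ultimately show ?thesis
    unfolding t_fun_def by (simp only: minus_divide_left)
qed

text \<open>The absolute value in the definition of \<^const>\<open>lambda_fun\<close> can be dropped.\<close>

lemma lambda_fun_eq: "lambda_fun K x = (SUP v\<in>sphere 0 1. t_fun K v x)"
proof -
  have "(\<forall>v\<in>sphere 0 1. \<bar>t_fun K v x\<bar> \<le> z) \<longleftrightarrow> (\<forall>v\<in>sphere 0 1. t_fun K v x \<le> z)" for z
  proof
    assume *: "\<forall>v\<in>sphere 0 1. t_fun K v x \<le> z"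
    show "\<forall>v\<in>sphere 0 1. \<bar>t_fun K v x\<bar> \<le> z"
    proof
      fix v :: "'a \<Rightarrow>\<^sub>L real" assume "v \<in> sphere 0 1"
      then have "t_fun K v x \<le> z" "t_fun K (- v) x \<le> z" using * by auto
      then show "\<bar>t_fun K v x\<bar> \<le> z" by (simp add: t_fun_minus)
    qed
  qed force
  then show ?thesis
    unfolding lambda_fun_def Sup_real_def by simp
qed

end

theory Submission imports Defs
begin

text \<open>
  Write \<open>t v\<close> for \<open>t_fun K v x\<close>. The numbers \<open>1 - t v\<close> and \<open>1 + t v\<close> are, up to the common factor
  \<open>2 / width_fun K v\<close>, the gaps in the value of \<open>v\<close> between \<open>x\<close> and the two supporting hyperplanes
  of \<open>K\<close> with normal \<open>v\<close>. Reflecting \<open>K\<close> in \<open>x\<close> exchanges these gaps, and scaling by \<open>l\<close>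
  multiplies them by \<open>l\<close>. So the copy \<open>- l (K - x) + x\<close> stays on the correct side of the
  supporting hyperplane in direction \<open>v\<close> if and only if \<open>l * (1 + t v) \<le> 1 - t v\<close>, that is,
  \<open>t v \<le> (1 - l) / (1 + l)\<close>. A closed convex set is the intersection of its supporting
  half-spaces, hence the copy lies in \<open>K\<close> if and only if this holds for all unit functionals \<open>v\<close>
  (\<open>reflection_subset_iff\<close>). Taking the supremum over \<open>v\<close>, the condition reads
  \<open>lambda_fun K x \<le> (1 - l) / (1 + l)\<close>, equivalently
  \<open>l \<le> (1 - lambda_fun K x) / (1 + lambda_fun K x)\<close>. So the largest admissible \<open>l\<close> is the claimed
  value.

  The analytic ingredient is the strict separation of a point from a closed convex set in an
  arbitrary normed space (\<open>separating_functional_closed_point\<close>), which also shows that the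
  dual sphere of a nonzero space is nonempty. It is derived from the Hahn--Banach theorem in the form that every
  sublinear functional dominates a linear one (\<open>hahn_banach_sublinear\<close>): by Zorn's lemma there is
  a minimal sublinear functional below the given one, and minimal sublinear functionals are
  linear. Both the linearity of minimal functionals and the separation theorem come from one
  construction, \<open>sublinear_tilt\<close>, which lowers a sublinear functional along a convex cone.
\<close>

section \<open>Sublinear functionals and the Hahn--Banach theorem\<close>

text \<open>
  The homogeneity condition is kept as weak as possible, to be checked easily for infima; equality
  follows by applying it to \<open>inverse c\<close>.
\<close>

definition sublinear :: "('a::real_vector \<Rightarrow> real) \<Rightarrow> bool" where
  "sublinear p \<longleftrightarrow>
     (\<forall>x y. p (x + y) \<le> p x + p y) \<and> (\<forall>x c. 0 < c \<longrightarrow> p (c *\<^sub>R x) \<le> c * p x)"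

lemma sublinear_add: "sublinear p \<Longrightarrow> p (x + y) \<le> p x + p y"
  by (simp add: sublinear_def)

lemma sublinear_scaleR:
  assumes "sublinear p" "0 < c"
  shows "p (c *\<^sub>R x) = c * p x"
proof (rule antisym)
  show "p (c *\<^sub>R x) \<le> c * p x"
    using assms by (simp add: sublinear_def)
  have "p (inverse c *\<^sub>R c *\<^sub>R x) \<le> inverse c * p (c *\<^sub>R x)"
    using assms unfolding sublinear_def by (meson positive_imp_inverse_positive)
  then show "c * p x \<le> p (c *\<^sub>R x)"
    using \<open>0 < c\<close> by (simp add: field_simps)
qed

lemma sublinear_0: "sublinear p \<Longrightarrow> p 0 = 0"
  using sublinear_scaleR[of p 2 0] by simp

lemma sublinear_minus_le: "sublinear p \<Longrightarrow> - p (- x) \<le> p x"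
  using sublinear_add[of p x "- x"] by (simp add: sublinear_0)

lemma sublinear_norm: "sublinear (norm :: 'a::real_normed_vector \<Rightarrow> real)"
  by (simp add: sublinear_def norm_triangle_ineq)

lemma sublinear_additive_imp_linear:
  assumes p: "sublinear p" and add: "\<And>x y. p (x + y) = p x + p y"
  shows "linear p"
proof (rule linearI)
  show "p (x + y) = p x + p y" for x y by (rule add)
  have minus: "p (- x) = - p x" for x
    using add[of x "- x"] by (simp add: sublinear_0[OF p])
  show "p (c *\<^sub>R x) = c *\<^sub>R p x" for c x
  proof (cases c "0 :: real" rule: linorder_cases)
    case less
    then show ?thesis
      using sublinear_scaleR[OF p, of "- c" x] minus[of "c *\<^sub>R x"] by simp
  qed (simp_all add: sublinear_0[OF p] sublinear_scaleR[OF p])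
qed

text \<open>
  A way to build the constraints \<open>s \<le> f w\<close>, for \<open>(w, s) \<in> C\<close>, on a linear functional \<open>f\<close> into the
  sublinear functional that is to dominate it: if \<open>f \<le> q\<close> then \<open>- f w = f (- w) \<le> q (- w) \<le> - s\<close>.
  The functional \<open>q\<close> is the infimum of the translates \<open>p (x + w) - s\<close>; it is sublinear because
  \<open>C\<close> is a convex cone, and finite because \<open>p\<close> itself satisfies the constraints.
\<close>

lemma sublinear_tilt:
  fixes p :: "'a::real_vector \<Rightarrow> real"
  assumes p: "sublinear p" and C: "convex_cone C" and le: "\<And>w s. (w, s) \<in> C \<Longrightarrow> s \<le> p w"
  obtains q where "sublinear q" "\<And>x. q x \<le> p x" "\<And>w s. (w, s) \<in> C \<Longrightarrow> q (- w) \<le> - s"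
proof
  define q where "q = (\<lambda>x. INF (w, s)\<in>C. p (x + w) - s)"
  have C0: "(0, 0) \<in> C"
    using convex_cone_contains_0[OF C] by (simp add: zero_prod_def)
  have bdd: "bdd_below ((\<lambda>(w, s). p (x + w) - s) ` C)" for x
  proof (rule bdd_belowI2[where m = "- p (- x)"])
    fix ws assume ws: "ws \<in> C"
    obtain w s where [simp]: "ws = (w, s)" by fastforce
    show "- p (- x) \<le> (case ws of (w, s) \<Rightarrow> p (x + w) - s)"
      using sublinear_add[OF p, of "x + w" "- x"] le[of w s] ws by simp
  qed
  have lower: "q x \<le> p (x + w) - s" if "(w, s) \<in> C" for x w s
    using cINF_lower[OF bdd that, of x] by (simp add: q_def)
  have greatest: "m \<le> q x" if "\<And>w s. (w, s) \<in> C \<Longrightarrow> m \<le> p (x + w) - s" for m x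
    unfolding q_def using C0 that by (intro cINF_greatest) auto
  show "q x \<le> p x" for x
    using lower[OF C0, of x] by simp
  show "q (- w) \<le> - s" if "(w, s) \<in> C" for w s
    using lower[OF that, of "- w"] by (simp add: sublinear_0[OF p])
  show "sublinear q"
    unfolding sublinear_def
  proof safe
    fix x y
    have "q (x + y) - (p (x + w) - s) \<le> q y" if ws: "(w, s) \<in> C" for w s
    proof (rule greatest)
      fix w' s' assume "(w', s') \<in> C"
      then have "(w + w', s + s') \<in> C"
        using convex_cone_add[OF C ws] by fastforce
      then have "q (x + y) \<le> p ((x + w) + (y + w')) - (s + s')"
        using lower[of "w + w'" "s + s'" "x + y"] by (simp add: algebra_simps)
      then show "q (x + y) - (p (x + w) - s) \<le> p (y + w') - s'"
        using sublinear_add[OF p, of "x + w" "y + w'"] by simp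
    qed
    then have "q (x + y) - q y \<le> q x"
      by (intro greatest) (smt (verit))
    then show "q (x + y) \<le> q x + q y" by simp
  next
    fix x and c :: real assume "0 < c"
    have "q (c *\<^sub>R x) / c \<le> q x"
    proof (rule greatest)
      fix w s assume "(w, s) \<in> C"
      then have "(c *\<^sub>R w, c * s) \<in> C"
        using convex_cone_scaleR[OF C, of c "(w, s)"] \<open>0 < c\<close> by simp
      then have "q (c *\<^sub>R x) \<le> p (c *\<^sub>R (x + w)) - c * s"
        using lower by (simp add: scaleR_add_right)
      also have "\<dots> = c * (p (x + w) - s)"
        using \<open>0 < c\<close> by (simp add: sublinear_scaleR[OF p] right_diff_distrib)
      finally show "q (c *\<^sub>R x) / c \<le> p (x + w) - s"
        using \<open>0 < c\<close> by (simp add: pos_divide_le_eq mult.commute)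
    qed
    then show "q (c *\<^sub>R x) \<le> c * q x"
      using \<open>0 < c\<close> by (simp add: field_simps)
  qed
qed

text \<open>
  Chains of sublinear functionals have a sublinear pointwise infimum, which is finite since
  \<open>- p (- x)\<close> bounds all the values at \<open>x\<close> from below. So Zorn's lemma applies.
\<close>

lemma sublinear_minimal_exists:
  fixes p :: "'a::real_vector \<Rightarrow> real"
  assumes p: "sublinear p"
  obtains m where "sublinear m" "\<And>x. m x \<le> p x"
    "\<And>q. sublinear q \<Longrightarrow> (\<And>x. q x \<le> m x) \<Longrightarrow> q = m"
proof -
  define A where "A = {q. sublinear q \<and> (\<forall>x. q x \<le> p x)}"
  define P where "P = (\<lambda>q r :: 'a \<Rightarrow> real. \<forall>x. r x \<le> q x)"
  have "\<exists>m\<in>A. \<forall>q\<in>A. P m q \<longrightarrow> q = m"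
  proof (rule predicate_Zorn)
    show "partial_order_on A (relation_of P A)"
      by (rule partial_order_on_relation_ofI) (auto simp: P_def fun_eq_iff intro: order_trans antisym)
  next
    fix C assume "C \<in> Chains (relation_of P A)"
    then have CA: "C \<subseteq> A" and chain: "\<And>q r. q \<in> C \<Longrightarrow> r \<in> C \<Longrightarrow> P q r \<or> P r q"
      by (auto simp: Chains_def relation_of_def)
    show "\<exists>u\<in>A. \<forall>q\<in>C. P q u"
    proof (cases "C = {}")
      case True
      then show ?thesis using p by (auto simp: A_def)
    next
      case False
      define u where "u = (\<lambda>x. INF q\<in>C. q x)"
      have "- p (- x) \<le> q x" if "q \<in> C" for q x
        using that CA sublinear_minus_le[of q x] by (force simp: A_def intro: order_trans[rotated])
      then have bdd: "bdd_below ((\<lambda>q. q x) ` C)" for x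
        by (rule bdd_belowI2)
      have lower: "u x \<le> q x" if "q \<in> C" for q x
        unfolding u_def by (rule cINF_lower[OF bdd that])
      have greatest: "m \<le> u x" if "\<And>q. q \<in> C \<Longrightarrow> m \<le> q x" for m x
        unfolding u_def using False that by (rule cINF_greatest)
      have "sublinear u"
        unfolding sublinear_def
      proof safe
        fix x y
        have "u (x + y) \<le> q x + r y" if "q \<in> C" "r \<in> C" for q r
        proof -
          \<comment> \<open>The smaller of two members of the chain witnesses both infima.\<close>
          obtain g where "g \<in> C" "g x \<le> q x" "g y \<le> r y"
            using chain[OF \<open>q \<in> C\<close> \<open>r \<in> C\<close>] \<open>q \<in> C\<close> \<open>r \<in> C\<close> unfolding P_def
            by (metis order_refl)
          moreover have "g (x + y) \<le> g x + g y"
            using \<open>g \<in> C\<close> CA by (auto simp: A_def intro: sublinear_add)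
          ultimately show ?thesis
            using lower[of g "x + y"] by linarith
        qed
        then have "u (x + y) - q x \<le> u y" if "q \<in> C" for q
          using that by (intro greatest) (smt (verit))
        then have "u (x + y) - u y \<le> u x"
          by (intro greatest) (smt (verit))
        then show "u (x + y) \<le> u x + u y" by simp
      next
        fix x and c :: real assume "0 < c"
        have "u (c *\<^sub>R x) / c \<le> u x"
        proof (rule greatest)
          fix q assume "q \<in> C"
          then have "u (c *\<^sub>R x) \<le> c * q x"
            using lower[of q "c *\<^sub>R x"] CA sublinear_scaleR[of q c x] \<open>0 < c\<close> by (auto simp: A_def)
          then show "u (c *\<^sub>R x) / c \<le> q x"
            using \<open>0 < c\<close> by (simp add: field_simps)
        qed
        then show "u (c *\<^sub>R x) \<le> c * u x"
          using \<open>0 < c\<close> by (simp add: field_simps)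
      qed
      moreover have "u x \<le> p x" for x
      proof -
        obtain q where "q \<in> C" using False by blast
        then show ?thesis
          using lower[of q x] CA by (force simp: A_def intro: order_trans)
      qed
      ultimately show ?thesis
        using lower by (intro bexI[of _ u]) (auto simp: A_def P_def)
    qed
  qed
  then obtain m where "m \<in> A" and min: "\<And>q. q \<in> A \<Longrightarrow> P m q \<Longrightarrow> q = m"
    by blast
  show thesis
  proof (rule that)
    show "sublinear m" and le: "m x \<le> p x" for x
      using \<open>m \<in> A\<close> by (auto simp: A_def)
    fix q assume "sublinear q" and "\<And>x. q x \<le> m x"
    then show "q = m"
      using le by (intro min) (auto simp: A_def P_def intro: order_trans)
  qed
qed

text \<open>
  Tilting a minimal \<open>m\<close> along the ray through \<open>(y, m y)\<close> gives nothing smaller, so \<open>m\<close> itself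
  satisfies \<open>m (- y) \<le> - m y\<close>. Hence \<open>m\<close> is odd, and subadditivity becomes additivity.
\<close>

lemma hahn_banach_sublinear:
  fixes p :: "'a::real_vector \<Rightarrow> real"
  assumes "sublinear p"
  obtains f where "linear f" "\<And>x. f x \<le> p x"
proof -
  obtain m where m: "sublinear m" and le: "\<And>x. m x \<le> p x"
    and min: "\<And>q. sublinear q \<Longrightarrow> (\<And>x. q x \<le> m x) \<Longrightarrow> q = m"
    using sublinear_minimal_exists[OF assms] by blast
  have odd: "m (- y) = - m y" for y
  proof (rule antisym)
    define C where "C = conic hull {(y, m y)}"
    have "convex_cone C"
      by (simp add: C_def convex_cone_def convex_conic_hull conic_conic_hull
        conic_hull_eq_empty)
    moreover have "s \<le> m w" if ws: "(w, s) \<in> C" for w s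
    proof -
      obtain c where "0 \<le> c" "w = c *\<^sub>R y" "s = c * m y"
        using ws by (auto simp: C_def conic_hull_explicit)
      then show ?thesis
        using sublinear_scaleR[OF m, of c y] sublinear_0[OF m] by (cases "c = 0") auto
    qed
    ultimately obtain q where q: "sublinear q" "\<And>x. q x \<le> m x"
      and tilt: "\<And>w s. (w, s) \<in> C \<Longrightarrow> q (- w) \<le> - s"
      using sublinear_tilt[OF m] by blast
    have "(y, m y) \<in> C"
      by (simp add: C_def hull_inc)
    then show "m (- y) \<le> - m y"
      using tilt[of y "m y"] min[OF q] by simp
    show "- m y \<le> m (- y)"
      using sublinear_minus_le[OF m, of "- y"] by simp
  qed
  have "m (x + y) = m x + m y" for x y
    using sublinear_add[OF m, of x y] sublinear_add[OF m, of "- x" "- y"]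
      odd[of x] odd[of y] odd[of "x + y"] by simp
  then have "linear m"
    by (rule sublinear_additive_imp_linear[OF m])
  then show thesis using le that by blast
qed

text \<open>
  If \<open>d\<close> is the distance from \<open>z\<close> to \<open>K\<close>, then \<open>d \<le> norm (z - y)\<close> for all \<open>y \<in> K\<close>. So the norm
  can be tilted along the cone generated by the pairs \<open>(z - y, d)\<close>, which is convex as \<open>K\<close> is. A
  linear functional below the result is bounded and increases by at least \<open>d > 0\<close> from every
  point of \<open>K\<close> to \<open>z\<close>.
\<close>

lemma separating_functional_closed_point:
  fixes K :: "'a::real_normed_vector set"
  assumes "closed K" "convex K" "K \<noteq> {}" "z \<notin> K"
  obtains v :: "'a \<Rightarrow>\<^sub>L real" and e :: real
  where "v \<in> sphere 0 1" "0 < e" "\<And>y. y \<in> K \<Longrightarrow> blinfun_apply v y + e \<le> blinfun_apply v z"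
proof -
  define d where "d = infdist z K"
  have "0 < d"
    unfolding d_def using assms by (intro infdist_pos_not_in_closed)
  define S where "S = (\<lambda>y. (z - y, d)) ` K"
  define C where "C = conic hull S"
  have S_eq: "S = (\<lambda>u. (z, d) + (- 1) *\<^sub>R u) ` (K \<times> {0})"
    by (auto simp: S_def image_iff)
  have "convex S"
    unfolding S_eq using assms(2) by (intro convex_affinity convex_Times) auto
  then have "convex_cone C"
    using assms(3) by (simp add: C_def S_def convex_cone_def convex_conic_hull conic_conic_hull
        conic_hull_eq_empty)
  moreover have "s \<le> norm w" if ws: "(w, s) \<in> C" for w s
  proof -
    obtain c y where "0 \<le> c" "y \<in> K" "w = c *\<^sub>R (z - y)" "s = c * d"
      using ws by (auto simp: C_def S_def conic_hull_explicit)
    then show ?thesis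
      using infdist_le[of y K z] by (simp add: d_def dist_norm mult_left_mono)
  qed
  ultimately obtain q where q: "sublinear q" "\<And>x. q x \<le> norm x"
    and tilt: "\<And>w s. (w, s) \<in> C \<Longrightarrow> q (- w) \<le> - s"
    using sublinear_tilt[OF sublinear_norm] by blast
  obtain f where f: "linear f" and fq: "\<And>x. f x \<le> q x"
    using hahn_banach_sublinear[OF q(1)] by blast
  have "norm (f x) \<le> norm x * 1" for x
    using order_trans[OF fq q(2), of x] order_trans[OF fq q(2), of "- x"]
    by (simp add: linear_neg[OF f])
  then have "bounded_linear f"
    using f by (intro bounded_linear_intro[where K = 1]) (simp_all add: linear_add linear_scale)
  define g where "g = Blinfun f"
  have g: "blinfun_apply g x = f x" for x
    by (simp add: g_def bounded_linear_Blinfun_apply[OF \<open>bounded_linear f\<close>])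
  have sep: "f y + d \<le> f z" if "y \<in> K" for y
  proof -
    have "(z - y, d) \<in> C"
      using that by (auto simp: C_def S_def intro: hull_inc)
    then show ?thesis
      using tilt[of "z - y" d] fq[of "y - z"] by (simp add: linear_diff[OF f])
  qed
  obtain y where "y \<in> K" using assms(3) by blast
  then have "f (z - y) \<noteq> 0"
    using sep[of y] \<open>0 < d\<close> by (simp add: linear_diff[OF f])
  then have "g \<noteq> 0"
    using g[of "z - y"] by auto
  show thesis
  proof (rule that[of "(1 / norm g) *\<^sub>R g" "d / norm g"])
    show "(1 / norm g) *\<^sub>R g \<in> sphere 0 1"
      using \<open>g \<noteq> 0\<close> by simp
    show "0 < d / norm g"
      using \<open>g \<noteq> 0\<close> \<open>0 < d\<close> by simp
    fix y assume "y \<in> K"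
    then have "(f y + d) / norm g \<le> f z / norm g"
      using sep by (intro divide_right_mono) auto
    then show "blinfun_apply ((1 / norm g) *\<^sub>R g) y + d / norm g
        \<le> blinfun_apply ((1 / norm g) *\<^sub>R g) z"
      by (simp add: blinfun.scaleR_left g add_divide_distrib)
  qed
qed

lemma dual_sphere_nonempty:
  assumes "(UNIV :: 'a::real_normed_vector set) \<noteq> {0}"
  shows "sphere (0 :: 'a \<Rightarrow>\<^sub>L real) 1 \<noteq> {}"
proof -
  obtain z :: 'a where "z \<noteq> 0" using assms by blast
  then show ?thesis
    using separating_functional_closed_point[of "{0}" z] by (metis closed_singleton
        convex_singleton empty_iff insert_not_empty singletonD)
qed

section \<open>Support function and width of a bounded set\<close>

lemma support_fun_upper:
  assumes "bounded K" "y \<in> K"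
  shows "blinfun_apply v y \<le> support_fun K v"
proof -
  have "bounded (blinfun_apply v ` K)"
    by (rule bounded_linear_image[OF assms(1) blinfun.bounded_linear_right])
  then show ?thesis
    unfolding support_fun_def using assms(2) by (intro cSUP_upper bounded_imp_bdd_above)
qed

lemma support_fun_least:
  assumes "K \<noteq> {}" "\<And>y. y \<in> K \<Longrightarrow> blinfun_apply v y \<le> m"
  shows "support_fun K v \<le> m"
  unfolding support_fun_def using assms by (rule cSUP_least)

text \<open>
  A nonzero functional takes different values at two points of any ball, so the width of a body
  in its direction does not vanish. This is where the interior of the body enters.
\<close>

lemma width_fun_pos:
  fixes K :: "'a::real_normed_vector set"
  assumes "bounded K" "interior K \<noteq> {}" "v \<noteq> 0"
  shows "0 < width_fun K v"
proof -
  obtain a e where "0 < e" and ball: "cball a e \<subseteq> K"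
    using assms(2) by (meson ex_in_conv mem_interior_cball)
  obtain u where u: "blinfun_apply v u \<noteq> 0"
    using assms(3) by (metis blinfun_eqI zero_blinfun.rep_eq)
  define r where "r = e * sgn (blinfun_apply v u) / norm u"
  have "u \<noteq> 0"
    using u by auto
  then have "norm (r *\<^sub>R u) \<le> e"
    using \<open>0 < e\<close> by (simp add: r_def abs_mult abs_sgn_eq)
  then have "a + r *\<^sub>R u \<in> K" "a \<in> K"
    using ball \<open>0 < e\<close> by (auto simp: dist_norm subset_iff)
  then have "blinfun_apply v (a + r *\<^sub>R u) \<le> support_fun K v"
    and "- blinfun_apply v a \<le> support_fun K (- v)"
    using support_fun_upper[OF assms(1), of "a + r *\<^sub>R u" v]
      support_fun_upper[OF assms(1), of a "- v"] by (simp_all add: blinfun.minus_left)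
  moreover have "0 < r * blinfun_apply v u"
  proof -
    have "r * blinfun_apply v u = e * \<bar>blinfun_apply v u\<bar> / norm u"
      by (simp add: r_def abs_sgn mult.commute mult.left_commute)
    then show ?thesis using u \<open>u \<noteq> 0\<close> \<open>0 < e\<close> by simp
  qed
  ultimately show ?thesis
    by (simp add: width_fun_def blinfun.add_right blinfun.scaleR_right)
qed

lemma one_minus_t_fun:
  assumes "width_fun K v \<noteq> 0"
  shows "1 - t_fun K v x = 2 * (support_fun K v - blinfun_apply v x) / width_fun K v"
  using assms by (simp add: t_fun_def width_fun_def field_simps)

lemma one_plus_t_fun:
  assumes "width_fun K v \<noteq> 0"
  shows "1 + t_fun K v x = 2 * (blinfun_apply v x + support_fun K (- v)) / width_fun K v"
  using assms by (simp add: t_fun_def width_fun_def field_simps)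

lemma abs_t_fun_le_1:
  assumes "bounded K" "x \<in> K" "0 < width_fun K v"
  shows "\<bar>t_fun K v x\<bar> \<le> 1"
proof -
  have "0 \<le> 1 - t_fun K v x" "0 \<le> 1 + t_fun K v x"
    using support_fun_upper[OF assms(1,2), of v] support_fun_upper[OF assms(1,2), of "- v"] assms(3)
    by (simp_all add: one_minus_t_fun one_plus_t_fun blinfun.minus_left)
  then show ?thesis by linarith
qed

section \<open>Homothetic reflections contained in a convex body\<close>

text \<open>
  A closed convex set is the intersection of the half-spaces given by its support function, so
  the inclusion can be tested one functional \<open>v\<close> at a time. The supremum of \<open>v\<close> over the
  reflected copy of \<open>K\<close> is \<open>v x + l * (v x + support_fun K (- v))\<close>; that this is at most
  \<open>support_fun K v\<close> is the inequality on the right, multiplied by half the width.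
\<close>

lemma reflection_subset_iff:
  fixes K :: "'a::real_normed_vector set"
  assumes "convex_body K" "x \<in> K" "0 \<le> l"
  shows "(\<lambda>y. - l *\<^sub>R (y - x) + x) ` K \<subseteq> K \<longleftrightarrow>
    (\<forall>v\<in>sphere 0 1. l * (1 + t_fun K v x) \<le> 1 - t_fun K v x)"
proof -
  have K: "bounded K" "closed K" "convex K" "interior K \<noteq> {}" "K \<noteq> {}"
    using assms(1,2) by (auto simp: convex_body_def)
  have val: "blinfun_apply v (- l *\<^sub>R (y - x) + x) =
      blinfun_apply v x + l * (blinfun_apply v x + blinfun_apply (- v) y)" for v y
    by (simp add: blinfun.add_right blinfun.scaleR_right blinfun.diff_right blinfun.minus_left
        blinfun.minus_right algebra_simps)
  have half: "l * (1 + t_fun K v x) \<le> 1 - t_fun K v x \<longleftrightarrow>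
      blinfun_apply v x + l * (blinfun_apply v x + support_fun K (- v)) \<le> support_fun K v"
    if "v \<in> sphere 0 1" for v
  proof -
    have "0 < width_fun K v"
      using that by (intro width_fun_pos K) auto
    moreover have "l * (2 * a / w) \<le> 2 * b / w \<longleftrightarrow> l * a \<le> b" if "0 < w" for a b w :: real
      using that by (simp add: divide_le_cancel times_divide_eq_right mult.left_commute)
    ultimately show ?thesis
      by (simp only: one_minus_t_fun one_plus_t_fun le_diff_eq add.commute less_imp_neq[symmetric]
          not_False_eq_True)
  qed
  show ?thesis
  proof safe
    fix v :: "'a \<Rightarrow>\<^sub>L real"
    assume sub: "(\<lambda>y. - l *\<^sub>R (y - x) + x) ` K \<subseteq> K" and v: "v \<in> sphere 0 1"
    have "blinfun_apply v x + l * (blinfun_apply v x + support_fun K (- v)) \<le> support_fun K v"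
    proof (cases "l = 0")
      case True
      then show ?thesis using support_fun_upper[OF K(1) assms(2)] by simp
    next
      case False
      then have "0 < l" using assms(3) by simp
      have "support_fun K (- v)
          \<le> (support_fun K v - blinfun_apply v x) / l - blinfun_apply v x"
      proof (rule support_fun_least[OF K(5)])
        fix y assume "y \<in> K"
        then have "blinfun_apply v (- l *\<^sub>R (y - x) + x) \<le> support_fun K v"
          using sub by (intro support_fun_upper[OF K(1)]) blast
        then show "blinfun_apply (- v) y
            \<le> (support_fun K v - blinfun_apply v x) / l - blinfun_apply v x"
          unfolding val using \<open>0 < l\<close> by (simp add: field_simps)
      qed
      then show ?thesis using \<open>0 < l\<close> by (simp add: field_simps)
    qed
    then show "l * (1 + t_fun K v x) \<le> 1 - t_fun K v x"
      using half[OF v] by simp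
  next
    fix y
    assume all: "\<forall>v\<in>sphere 0 1. l * (1 + t_fun K v x) \<le> 1 - t_fun K v x" and y: "y \<in> K"
    show "- l *\<^sub>R (y - x) + x \<in> K"
    proof (rule ccontr)
      assume "- l *\<^sub>R (y - x) + x \<notin> K"
      then obtain v :: "'a \<Rightarrow>\<^sub>L real" and e where v: "v \<in> sphere 0 1" and "0 < e"
        and sep: "\<And>u. u \<in> K \<Longrightarrow> blinfun_apply v u + e \<le> blinfun_apply v (- l *\<^sub>R (y - x) + x)"
        using separating_functional_closed_point[OF K(2,3,5)] by blast
      have "support_fun K v \<le> blinfun_apply v (- l *\<^sub>R (y - x) + x) - e"
        using sep by (intro support_fun_least[OF K(5)]) (simp add: le_diff_eq)
      moreover have "l * blinfun_apply (- v) y \<le> l * support_fun K (- v)"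
        using support_fun_upper[OF K(1) y] assms(3) by (rule mult_left_mono)
      moreover have "blinfun_apply v x + l * (blinfun_apply v x + support_fun K (- v))
          \<le> support_fun K v"
        using all v half by blast
      ultimately show False
        using \<open>0 < e\<close> unfolding val by (simp add: algebra_simps)
    qed
  qed
qed

theorem proposition4p8:
  fixes K :: "'a::real_normed_vector set" and x :: 'a
  assumes "(UNIV :: 'a set) \<noteq> {0}"
    and "convex_body K"
    and "x \<in> K"
  shows "beta_fun K x = (1 - lambda_fun K x) / (1 + lambda_fun K x)"
proof -
  have K: "bounded K" "interior K \<noteq> {}"
    using assms(2) by (auto simp: convex_body_def)
  define lam where "lam = lambda_fun K x"
  obtain v0 :: "'a \<Rightarrow>\<^sub>L real" where v0: "v0 \<in> sphere 0 1"
    using dual_sphere_nonempty[OF assms(1)] by blast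
  have le1: "\<bar>t_fun K v x\<bar> \<le> 1" if "v \<in> sphere 0 1" for v
    using that by (intro abs_t_fun_le_1 width_fun_pos K assms(3)) auto
  have bdd: "bdd_above ((\<lambda>v. \<bar>t_fun K v x\<bar>) ` sphere 0 1)"
    using le1 by (rule bdd_aboveI2)
  have t_le: "\<bar>t_fun K v x\<bar> \<le> lam" if "v \<in> sphere 0 1" for v
    unfolding lam_def lambda_fun_def using that bdd by (rule cSUP_upper)
  have "0 \<le> lam"
    using t_le[OF v0] by linarith
  have "lam \<le> 1"
    unfolding lam_def lambda_fun_def using v0 le1 by (intro cSUP_least) auto
  have lam_le_iff: "lam \<le> c \<longleftrightarrow> (\<forall>v\<in>sphere 0 1. t_fun K v x \<le> c)" for c
  proof
    assume "lam \<le> c"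
    then show "\<forall>v\<in>sphere 0 1. t_fun K v x \<le> c"
      using t_le by fastforce
  next
    assume "\<forall>v\<in>sphere 0 1. t_fun K v x \<le> c"
    then show "lam \<le> c"
      unfolding lam_def lambda_fun_eq using v0 by (intro cSUP_least) auto
  qed
  \<comment> \<open>The map \<open>r \<mapsto> (1 - r) / (1 + r)\<close> is a decreasing involution, which turns the bound on all
    the \<open>t_fun K v x\<close> into a bound on \<open>l\<close>.\<close>
  have swap: "l * (1 + r) \<le> 1 - r \<longleftrightarrow> r \<le> (1 - l) / (1 + l)" if "0 \<le> l" for l r :: real
    using that by (simp add: field_simps)
  have "{l. 0 \<le> l \<and> (\<lambda>y. - l *\<^sub>R (y - x) + x) ` K \<subseteq> K} = {0..(1 - lam) / (1 + lam)}"
  proof (intro set_eqI)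
    fix l :: real
    have "(\<lambda>y. - l *\<^sub>R (y - x) + x) ` K \<subseteq> K \<longleftrightarrow> l \<le> (1 - lam) / (1 + lam)" if "0 \<le> l"
    proof -
      have "(\<lambda>y. - l *\<^sub>R (y - x) + x) ` K \<subseteq> K \<longleftrightarrow> lam \<le> (1 - l) / (1 + l)"
        using reflection_subset_iff[OF assms(2,3) that] swap[OF that] lam_le_iff by auto
      also have "\<dots> \<longleftrightarrow> l \<le> (1 - lam) / (1 + lam)"
        using that \<open>0 \<le> lam\<close> by (simp add: field_simps)
      finally show ?thesis .
    qed
    then show "l \<in> {l. 0 \<le> l \<and> (\<lambda>y. - l *\<^sub>R (y - x) + x) ` K \<subseteq> K}
        \<longleftrightarrow> l \<in> {0..(1 - lam) / (1 + lam)}"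
      by (auto simp: image_subset_iff)
  qed
  moreover have "0 \<le> (1 - lam) / (1 + lam)"
    using \<open>0 \<le> lam\<close> \<open>lam \<le> 1\<close> by simp
  ultimately show ?thesis
    unfolding beta_fun_def lam_def by simp
qed

end
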